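(* Let $t\ge 3$ be an odd integer and let $S=(1,1,2,2,\ldots)$, i.e. $a_1=a_2=1$ and $a_i=2$ for all $i\ge 3$. Then $\chi_S(G_t)=4$.
   Context: For an odd integer $t\ge 3$, $G_t$ denotes the integer distance graph $G(\mathbb{Z},\{2,t\})$: its vertex set is $\mathbb{Z}$, and distinct $i,j\in\mathbb{Z}$ are adjacent if and only if $|i-j|\in\{2,t\}$. For a graph $G$ and a non-decreasing sequence $S=(a_1,a_2,\ldots)$ of positive integers, an $S$-packing $k$-coloring of $G$ is a map $f:V(G)\to\{1,\ldots,k\}$ such that any two distinct vertices $u,v$ with $f(u)=f(v)=i$ satisfy $d_G(u,v)>a_i$, where $d_G$ is the shortest-path distance. The $S$-packing chromatic number $\chi_S(G)$ is the smallest $k$ for which $G$ has an $S$-packing $k$-coloring. *)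

theory Defs
  imports "HOL-Library.Extended_Nat"
begin

text \<open>
  A graph whose vertex set is a whole type is given by its adjacency predicate.
  The relational power \<open>(adj ^^ n) u v\<close> says that there is a walk of length \<open>n\<close> from
  \<open>u\<close> to \<open>v\<close>; the distance is \<open>\<infinity>\<close> if there is no walk at all.
\<close>

definition graph_dist :: "('v \<Rightarrow> 'v \<Rightarrow> bool) \<Rightarrow> 'v \<Rightarrow> 'v \<Rightarrow> enat" where
  "graph_dist adj u v = (INF n \<in> {n. (adj ^^ n) u v}. enat n)"

text \<open>
  A sequence \<open>S = (a\<^sub>1, a\<^sub>2, \<dots>)\<close> is a function on \<^typ>\<open>nat\<close> whose value at \<open>0\<close> is never used.
\<close>

definition S_packing_coloring ::
    "(nat \<Rightarrow> nat) \<Rightarrow> ('v \<Rightarrow> 'v \<Rightarrow> bool) \<Rightarrow> nat \<Rightarrow> ('v \<Rightarrow> nat) \<Rightarrow> bool" where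
  "S_packing_coloring S adj k f \<longleftrightarrow>
     (\<forall>v. f v \<in> {1..k}) \<and>
     (\<forall>u v. u \<noteq> v \<longrightarrow> f u = f v \<longrightarrow> graph_dist adj u v > enat (S (f u)))"

text \<open>The value is \<open>\<infinity>\<close> if no number of colors suffices.\<close>

definition S_packing_chromatic_number ::
    "(nat \<Rightarrow> nat) \<Rightarrow> ('v \<Rightarrow> 'v \<Rightarrow> bool) \<Rightarrow> enat" where
  "S_packing_chromatic_number S adj =
     (INF k \<in> {k. \<exists>f. S_packing_coloring S adj k f}. enat k)"

definition int_distance_adj :: "int set \<Rightarrow> int \<Rightarrow> int \<Rightarrow> bool" where
  "int_distance_adj D i j \<longleftrightarrow> i \<noteq> j \<and> \<bar>i - j\<bar> \<in> D"

definition seq_1_1_2_2 :: "nat \<Rightarrow> nat" where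
  "seq_1_1_2_2 i = (if i \<le> 2 then 1 else 2)"

end

theory Submission
  imports Defs
begin

text \<open>
  Lower bound: let only the colors 1, 2, 3 be used. The eight vertices
  \<open>v \<plusminus> 2, v \<plusminus> t, v \<plusminus> 2 \<plusminus> t\<close> around a vertex \<open>v\<close> of color 3 form a closed walk avoiding color 3,
  so colors 1 and 2 alternate along it and all four neighbors of \<open>v\<close> have the same color.
  Giving \<open>v\<close> the other one of the colors 1, 2 yields a proper 2-coloring, which contradicts
  the odd cycle \<open>0, 2, \<dots>, 2t, t\<close>.

  Upper bound: modulo \<open>n = t + 2\<close> both steps \<open>2\<close> and \<open>t\<close> become \<open>\<plusminus>2\<close>, so the graph maps to a cycle
  of odd length \<open>n\<close>. The colors 1, 2 alternate on this cycle with the vertex 0 removed, and the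
  multiples of \<open>n\<close> are colored alternately 3 and 4; equal ones then differ by at least
  \<open>2n > 2t\<close>.
\<close>

lemma enat_less_graph_dist_iff:
  "enat k < graph_dist adj u v \<longleftrightarrow> (\<forall>n\<le>k. \<not> (adj ^^ n) u v)"
proof
  assume "enat k < graph_dist adj u v"
  then have "k < n" if "(adj ^^ n) u v" for n
    using that unfolding graph_dist_def by (auto dest: less_INF_D)
  then show "\<forall>n\<le>k. \<not> (adj ^^ n) u v" by (meson not_le)
next
  assume *: "\<forall>n\<le>k. \<not> (adj ^^ n) u v"
  \<comment> \<open>A strict bound need not survive an infimum, so \<open>Suc k\<close> serves as a
    non-strict lower bound for all walk lengths; an empty set of lengths is covered too.\<close>
  have "enat (Suc k) \<le> graph_dist adj u v"
    unfolding graph_dist_def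
  proof (rule INF_greatest)
    fix n assume "n \<in> {n. (adj ^^ n) u v}"
    with * have "\<not> n \<le> k" by blast
    then show "enat (Suc k) \<le> enat n" by simp
  qed
  then show "enat k < graph_dist adj u v"
    by (metis enat_ord_simps(2) less_le_trans lessI)
qed

lemma enat_1_less_graph_dist_iff:
  "enat 1 < graph_dist adj u v \<longleftrightarrow> u \<noteq> v \<and> \<not> adj u v"
  unfolding enat_less_graph_dist_iff by (auto simp: le_Suc_eq)

lemma enat_2_less_graph_dist_iff:
  "enat 2 < graph_dist adj u v \<longleftrightarrow> u \<noteq> v \<and> \<not> adj u v \<and> (\<forall>w. adj u w \<longrightarrow> \<not> adj w v)"
  unfolding enat_less_graph_dist_iff
  by (auto simp: le_Suc_eq numeral_2_eq_2 relcompp_apply)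

lemma int_distance_adj_2_iff:
  assumes "t > 0"
  shows "int_distance_adj {2, t} i j \<longleftrightarrow> j \<in> {i + 2, i - 2, i + t, i - t}"
  using assms unfolding int_distance_adj_def by auto

text \<open>From 0 to \<open>2 * t\<close> there are \<open>t\<close> steps of size 2, an odd number
  of flips, but also two steps of size \<open>t\<close>, an even number.\<close>

lemma int_distance_2_odd_not_bipartite:
  fixes t :: int and g :: "int \<Rightarrow> bool"
  assumes "t \<ge> 0" "odd t"
    and step2: "\<And>i. g (i + 2) \<longleftrightarrow> \<not> g i"
    and stept: "\<And>i. g (i + t) \<longleftrightarrow> \<not> g i"
  shows False
proof -
  have iter: "g (2 * int n) \<longleftrightarrow> (if even n then g 0 else \<not> g 0)" for n
  proof (induction n)
    case (Suc n)
    show ?case using Suc step2[of "2 * int n"] by (auto simp: add.commute)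
  qed simp
  have "g (2 * t) \<longleftrightarrow> \<not> g 0"
    using iter[of "nat t"] assms(1,2) by (simp add: even_nat_iff)
  moreover have "g (2 * t) \<longleftrightarrow> g 0"
    using stept[of 0] stept[of t] by simp
  ultimately show False by blast
qed

lemma no_1_1_2_packing_coloring:
  fixes t :: int
  assumes t: "t \<ge> 3" "odd t"
    and f: "S_packing_coloring seq_1_1_2_2 (int_distance_adj {2, t}) 3 f"
  shows False
proof -
  let ?A = "int_distance_adj {2, t}"
  have adj: "?A i j \<longleftrightarrow> j \<in> {i + 2, i - 2, i + t, i - t}" for i j
    using t by (intro int_distance_adj_2_iff) simp
  have range: "f i = 1 \<or> f i = 2 \<or> f i = 3" for i
  proof -
    have "f i \<in> {1..3}" using f unfolding S_packing_coloring_def by blast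
    then show ?thesis by auto
  qed
  have dist: "enat (seq_1_1_2_2 (f u)) < graph_dist ?A u v" if "u \<noteq> v" "f u = f v" for u v
    using f that unfolding S_packing_coloring_def by blast
  have proper: "f i \<noteq> f j" if "?A i j" for i j
  proof
    assume eq: "f i = f j"
    have "i \<noteq> j" using that unfolding int_distance_adj_def by blast
    with dist[OF _ eq] have "enat (seq_1_1_2_2 (f i)) < graph_dist ?A i j" by blast
    moreover have "1 \<le> seq_1_1_2_2 (f i)" by (simp add: seq_1_1_2_2_def)
    ultimately have "\<not> (?A ^^ 1) i j" unfolding enat_less_graph_dist_iff by blast
    with that show False by (simp add: eq_OO)
  qed
  have packing: "f j \<noteq> 3" if "f i = 3" "?A i w" "?A w j" "i \<noteq> j" for i w j
    using dist[of i j] that unfolding seq_1_1_2_2_def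
    by (auto simp: enat_2_less_graph_dist_iff)
  have proper2: "f (i + 2) \<noteq> f i" and propert: "f (i + t) \<noteq> f i" for i
    using proper[of i "i + 2"] proper[of i "i + t"] by (auto simp: adj)
  \<comment> \<open>Each corner is two steps away from \<open>i\<close>, and differs from
    \<open>i\<close> because \<open>t\<close> exceeds 2.\<close>
  have corners: "f (i + 2 + t) \<noteq> 3" "f (i + 2 - t) \<noteq> 3" "f (i - 2 + t) \<noteq> 3" "f (i - 2 - t) \<noteq> 3"
    if "f i = 3" for i
    using packing[OF that, of "i + 2" "i + 2 + t"] packing[OF that, of "i + 2" "i + 2 - t"]
      packing[OF that, of "i - 2" "i - 2 + t"] packing[OF that, of "i - 2" "i - 2 - t"] t
    by (auto simp: adj)
  have neighbors: "f (i + t) = f (i + 2)" "f (i - t) = f (i + 2)" "f (i - 2) = f (i + 2)"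
    if i: "f i = 3" for i
  proof -
    have no3: "f (i + 2) \<noteq> 3" "f (i - 2) \<noteq> 3" "f (i + t) \<noteq> 3" "f (i - t) \<noteq> 3"
      using proper2[of i] proper2[of "i - 2"] propert[of i] propert[of "i - t"] i by auto
    \<comment> \<open>With color 3 excluded at all three vertices, \<open>x\<close> and
      \<open>y\<close> both get the color in {1, 2} that \<open>c\<close> lacks.\<close>
    have turn: "f x = f y" if "?A x c" "?A c y" "f x \<noteq> 3" "f y \<noteq> 3" "f c \<noteq> 3" for x y c
      using proper[OF that(1)] proper[OF that(2)] range[of x] range[of y] range[of c] that(3-5)
      by auto
    show 1: "f (i + t) = f (i + 2)"
      by (rule turn[of _ "i + 2 + t"]) (use no3 corners[OF i] in \<open>auto simp: adj\<close>)
    show "f (i - t) = f (i + 2)"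
      by (rule turn[of _ "i + 2 - t"]) (use no3 corners[OF i] in \<open>auto simp: adj\<close>)
    have "f (i - 2) = f (i + t)"
      by (rule turn[of _ "i - 2 + t"]) (use no3 corners[OF i] in \<open>auto simp: adj\<close>)
    with 1 show "f (i - 2) = f (i + 2)" by simp
  qed
  \<comment> \<open>\<open>g\<close> marks color 1 after recoloring: if \<open>f i = 3\<close>, then
    \<open>f (i + 2)\<close> is the common color of all four neighbors, and \<open>i\<close> takes
    the other one.\<close>
  define g where "g i \<longleftrightarrow> (if f i = 3 then f (i + 2) = 2 else f i = 1)" for i
  have flip: "g j \<longleftrightarrow> \<not> g i" if "j = i + 2 \<or> j = i + t" for i j
  proof -
    have "?A i j" using that by (auto simp: adj)
    then have ne: "f i \<noteq> f j" by (rule proper)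
    have "f j = f (i + 2)" if "f i = 3"
      using neighbors[OF that] \<open>j = i + 2 \<or> j = i + t\<close> by auto
    moreover have "f i = f (j + 2)" if "f j = 3"
      using neighbors[OF that] \<open>j = i + 2 \<or> j = i + t\<close> by auto
    ultimately show ?thesis
      using ne range[of i] range[of j] unfolding g_def by auto
  qed
  show False
    by (rule int_distance_2_odd_not_bipartite[of t g]) (use t flip in auto)
qed

text \<open>Each step moves by at most \<open>t\<close>. Hence integers that are far apart are also
  far apart in the graph.\<close>

lemma relpowp_int_distance_adj_bound:
  assumes "(int_distance_adj D ^^ n) u v" "\<And>d. d \<in> D \<Longrightarrow> d \<le> t"
  shows "\<bar>u - v\<bar> \<le> int n * t"
  using assms(1)
proof (induction n arbitrary: v)
  case (Suc n)
  then obtain w where "(int_distance_adj D ^^ n) u w" "int_distance_adj D w v" by auto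
  then have "\<bar>u - w\<bar> \<le> int n * t" "\<bar>w - v\<bar> \<le> t"
    using Suc.IH assms(2) unfolding int_distance_adj_def by auto
  then show ?case by (simp add: algebra_simps)
qed simp

lemma ex_1_1_2_2_packing_coloring:
  fixes t :: int
  assumes t: "t \<ge> 3" "odd t"
  shows "\<exists>f. S_packing_coloring seq_1_1_2_2 (int_distance_adj {2, t}) 4 f"
proof -
  let ?A = "int_distance_adj {2, t}"
  define n where "n = t + 2"
  define m where "m = (n + 1) div 2"
  have n: "n \<ge> 5" and m: "2 * m = n + 1" using t by (auto simp: n_def m_def)
  \<comment> \<open>The position on the cycle of steps 2 modulo \<open>n\<close>, since \<open>m\<close> is the inverse of 2.\<close>
  define h where "h i = (m * i) mod n" for i
  have h_period: "h (i + n) = h i" for i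
    by (simp add: h_def distrib_left)
  have h_step: "h (i + 2) = (h i + 1) mod n" for i
  proof -
    have "m * (i + 2) = (m * i + 1) + n" using m by (simp add: algebra_simps)
    then show ?thesis by (simp add: h_def mod_add_left_eq)
  qed
  have h_zero: "n dvd i" if "h i = 0" for i
  proof -
    have "n dvd m * i" using that by (auto simp: h_def)
    then have "n dvd 2 * (m * i)" by simp
    also have "2 * (m * i) = n * i + i"
      using m by (metis distrib_right mult.assoc mult_1)
    finally show ?thesis by (simp add: dvd_add_right_iff)
  qed
  define f :: "int \<Rightarrow> nat" where
    "f i = (if h i = 0 then if even (i div n) then 3 else 4 else if even (h i) then 2 else 1)" for i
  have h_range: "0 \<le> h i" "h i < n" for i using n by (auto simp: h_def)
  have step: "f (i + 2) \<noteq> f i" if "f i \<le> 2" for i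
  proof
    assume eq: "f (i + 2) = f i"
    have nz: "h i \<noteq> 0" "h (i + 2) \<noteq> 0" using that eq by (auto simp: f_def split: if_splits)
    \<comment> \<open>Wrapping around would land on position 0, whose color is 3 or 4. Without it
      the parity of the position flips.\<close>
    have "h i + 1 \<noteq> n" using nz(2) unfolding h_step by auto
    then have "h (i + 2) = h i + 1"
      using h_range[of i] unfolding h_step by (intro mod_pos_pos_trivial) auto
    with eq nz show False by (auto simp: f_def split: if_splits)
  qed
  \<comment> \<open>The restriction is essential: a shift by \<open>n\<close> exchanges colors 3 and
    4.\<close>
  have f_period: "f (i + n) = f i" if "f i \<le> 2" for i
    using that by (auto simp: f_def h_period split: if_splits)
  have stept: "f (i + t) \<noteq> f i" if "f i \<le> 2" for i
    \<comment> \<open>One more step of 2 from \<open>i + t\<close> reaches \<open>i + n\<close>,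
      which has the color of \<open>i\<close>.\<close>
    using step[of "i + t"] f_period[of i] that by (auto simp: n_def add.assoc)
  have small: "\<not> ?A u v" if "f u = f v" "f u \<le> 2" for u v
    using step[of u] step[of v] stept[of u] stept[of v] that t
      int_distance_adj_2_iff[of t u v] by auto
  have large: "u = v" if "f u = f v" "f u > 2" "(?A ^^ k) u v" "k \<le> 2" for u v k
  proof -
    have "h u = 0" "h v = 0" and par: "even (u div n) \<longleftrightarrow> even (v div n)"
      using that(1,2) by (auto simp: f_def split: if_splits)
    then obtain a b where ab: "u = n * a" "v = n * b" by (meson h_zero dvdE)
    \<comment> \<open>Here \<open>a\<close> and \<open>b\<close> are the quotients by
      \<open>n\<close>, whose parity the color 3 or 4 records.\<close>
    have "even (a - b)" using par n by (auto simp: ab)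
    then obtain c where "a - b = 2 * c" by (rule evenE)
    then have uv: "u - v = 2 * n * c"
      unfolding ab by (metis right_diff_distrib mult.assoc mult.commute)
    have "\<bar>u - v\<bar> \<le> int k * t"
      using that(3) by (rule relpowp_int_distance_adj_bound) (use t in auto)
    also have "\<dots> \<le> 2 * t" using that(4) t by (intro mult_right_mono) auto
    also have "\<dots> < 2 * n" by (simp add: n_def)
    finally have "u - v = 0"
      using uv dvd_imp_le_int[of "u - v" "2 * n"] n by fastforce
    then show ?thesis by simp
  qed
  have "S_packing_coloring seq_1_1_2_2 ?A 4 f"
    unfolding S_packing_coloring_def
  proof (intro conjI allI impI)
    show "f v \<in> {1..4}" for v by (auto simp: f_def)
    fix u v assume uv: "u \<noteq> v" "f u = f v"
    show "enat (seq_1_1_2_2 (f u)) < graph_dist ?A u v"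
    proof (cases "f u \<le> 2")
      case True
      then have "seq_1_1_2_2 (f u) = 1" by (simp add: seq_1_1_2_2_def)
      then show ?thesis
        using small[OF uv(2) True] uv(1) by (simp only: enat_1_less_graph_dist_iff) simp
    next
      case False
      then have "seq_1_1_2_2 (f u) = 2" by (simp add: seq_1_1_2_2_def)
      then show ?thesis
        using large[OF uv(2)] False uv(1) by (auto simp: enat_less_graph_dist_iff)
    qed
  qed
  then show ?thesis by blast
qed

lemma S_packing_coloring_mono:
  assumes "S_packing_coloring S adj k f" "k \<le> l"
  shows "S_packing_coloring S adj l f"
  using assms unfolding S_packing_coloring_def by fastforce

theorem theorem2:
  fixes t :: int
  assumes "t \<ge> 3" and "odd t"
  shows "S_packing_chromatic_number seq_1_1_2_2 (int_distance_adj {2, t}) = 4"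
proof (rule antisym)
  have "S_packing_chromatic_number seq_1_1_2_2 (int_distance_adj {2, t}) \<le> enat 4"
    unfolding S_packing_chromatic_number_def
    by (rule INF_lower) (use ex_1_1_2_2_packing_coloring[OF assms] in simp)
  then show "S_packing_chromatic_number seq_1_1_2_2 (int_distance_adj {2, t}) \<le> 4"
    by (simp add: numeral_eq_enat)
  have "enat 4 \<le> S_packing_chromatic_number seq_1_1_2_2 (int_distance_adj {2, t})"
    unfolding S_packing_chromatic_number_def
  proof (rule INF_greatest)
    fix k assume "k \<in> {k. \<exists>f. S_packing_coloring seq_1_1_2_2 (int_distance_adj {2, t}) k f}"
    then obtain f where "S_packing_coloring seq_1_1_2_2 (int_distance_adj {2, t}) k f" by blast
    then have "\<not> k \<le> 3"
      using no_1_1_2_packing_coloring[OF assms] S_packing_coloring_mono by blast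
    then show "enat 4 \<le> enat k" by simp
  qed
  then show "4 \<le> S_packing_chromatic_number seq_1_1_2_2 (int_distance_adj {2, t})"
    by (simp add: numeral_eq_enat)
qed

end
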